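(* Let $F\colon\mathbb{R}^n\rightrightarrows\mathbb{R}^n$ be a set-valued mapping whose graph is (locally) closed around $(\bar x,\bar v)\in\mathrm{gph}\,F$. If $F$ is strongly metrically regular around $(\bar x,\bar v)$, then there is a neighborhood $U\times V$ of $(\bar x,\bar v)$ such that for each $(x,v)\in\mathrm{gph}\,F\cap(U\times V)$ there exists a direction $d\in\mathbb{R}^n$ satisfying $$-v\in D^*F(x,v)(d).$$ Moreover, the set $\Gamma_F(x,v):=\{d\in\mathbb{R}^n:-v\in D^*F(x,v)(d)\}$ is compact for all $(x,v)\in\mathrm{gph}\,F\cap(U\times V)$.
   Context: For $\Omega\subset\mathbb{R}^s$ and $\bar z\in\Omega$, the regular normal cone is $\widehat N_\Omega(\bar z)=\{v:\limsup_{z\to\bar z,\,z\in\Omega}\frac{\langle v,z-\bar z\rangle}{\|z-\bar z\|}\le 0\}$, and the limiting normal cone is $N_\Omega(\bar z)=\{v:\exists\, z_k\to\bar z,\ z_k\in\Omega,\ v_k\to v\text{ with }v_k\in\widehat N_\Omega(z_k)\}$. For $F\colon\mathbb{R}^n\rightrightarrows\mathbb{R}^m$, $\mathrm{gph}\,F=\{(x,y):y\in F(x)\}$, $F^{-1}(y)=\{x:y\in F(x)\}$, and for $(x,y)\in\mathrm{gph}\,F$ the limiting coderivative is $D^*F(x,y)(v)=\{u\in\mathbb{R}^n:(u,-v)\in N_{\mathrm{gph}\,F}(x,y)\}$, $v\in\mathbb{R}^m$. $F$ is metrically regular around $(\bar x,\bar y)\in\mathrm{gph}\,F$ with modulus $\mu>0$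 if there are neighborhoods $U$ of $\bar x$ and $V$ of $\bar y$ such that $\mathrm{dist}(x;F^{-1}(y))\le\mu\,\mathrm{dist}(y;F(x))$ for all $(x,y)\in U\times V$ (distance to the empty set is $\infty$). If in addition $F^{-1}$ has a single-valued localization around $(\bar y,\bar x)$, i.e. there are neighborhoods $V$ of $\bar y$ and $U$ of $\bar x$ such that the mapping with graph $\mathrm{gph}\,F^{-1}\cap(V\times U)$ is single-valued on $V$, then $F$ is strongly metrically regular around $(\bar x,\bar y)$. *)

theory Defs
  imports "HOL-Analysis.Analysis"
begin

text \<open>The cones below are meant for base points in \<open>S\<close>, and the coderivative for points
  of the graph; nothing is intended by their values elsewhere.\<close>

text \<open>The upper limit is taken in the extended reals over \<open>w \<in> S - {z}\<close>; at an isolated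
  point of \<open>S\<close> it is \<open>-\<infinity>\<close>, so that every vector is normal there.\<close>

definition regular_normal_cone :: "'a::real_inner set \<Rightarrow> 'a \<Rightarrow> 'a set" where
  "regular_normal_cone S z =
     {v. Limsup (at z within S) (\<lambda>w. ereal (inner v (w - z) / norm (w - z))) \<le> 0}"

definition limiting_normal_cone :: "'a::real_inner set \<Rightarrow> 'a \<Rightarrow> 'a set" where
  "limiting_normal_cone S z =
     {v. \<exists>zs vs. zs \<longlonglongrightarrow> z \<and> (\<forall>k::nat. zs k \<in> S) \<and> vs \<longlonglongrightarrow> v \<and>
           (\<forall>k. vs k \<in> regular_normal_cone S (zs k))}"

definition gph :: "('a \<Rightarrow> 'b set) \<Rightarrow> ('a \<times> 'b) set" where
  "gph F = {(x, y). y \<in> F x}"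

definition inv_map :: "('a \<Rightarrow> 'b set) \<Rightarrow> 'b \<Rightarrow> 'a set" where
  "inv_map F y = {x. y \<in> F x}"

definition coderivative ::
  "('a::real_inner \<Rightarrow> 'b::real_inner set) \<Rightarrow> 'a \<Rightarrow> 'b \<Rightarrow> 'b \<Rightarrow> 'a set" where
  "coderivative F x y v = {u. (u, - v) \<in> limiting_normal_cone (gph F) (x, y)}"

text \<open>Unlike \<open>infdist\<close> (which is \<open>0\<close> for the empty set), this is \<open>\<infinity>\<close> for the empty set.\<close>

definition set_dist :: "'a::metric_space \<Rightarrow> 'a set \<Rightarrow> ereal" where
  "set_dist x A = (INF a\<in>A. ereal (dist x a))"

text \<open>Neighborhoods need not be open.\<close>

definition nbhd :: "'a::topological_space \<Rightarrow> 'a set \<Rightarrow> bool" where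
  "nbhd x U \<longleftrightarrow> x \<in> interior U"

definition locally_closed_around :: "'a::topological_space set \<Rightarrow> 'a \<Rightarrow> bool" where
  "locally_closed_around S z \<longleftrightarrow> (\<exists>W. closed W \<and> nbhd z W \<and> closed (S \<inter> W))"

definition metrically_regular ::
  "('a::metric_space \<Rightarrow> 'b::metric_space set) \<Rightarrow> 'a \<Rightarrow> 'b \<Rightarrow> real \<Rightarrow> bool" where
  "metrically_regular F xb yb \<mu> \<longleftrightarrow> \<mu> > 0 \<and>
     (\<exists>U V. nbhd xb U \<and> nbhd yb V \<and>
        (\<forall>x\<in>U. \<forall>y\<in>V. set_dist x (inv_map F y) \<le> ereal \<mu> * set_dist y (F x)))"

definition single_valued_localization ::
  "('b::topological_space \<Rightarrow> 'a::topological_space set) \<Rightarrow> 'b \<Rightarrow> 'a \<Rightarrow> bool" where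
  "single_valued_localization G yb xb \<longleftrightarrow>
     (\<exists>V U. nbhd yb V \<and> nbhd xb U \<and> (\<forall>y\<in>V. \<exists>!x. (y, x) \<in> gph G \<inter> (V \<times> U)))"

definition strongly_metrically_regular ::
  "('a::metric_space \<Rightarrow> 'b::metric_space set) \<Rightarrow> 'a \<Rightarrow> 'b \<Rightarrow> bool" where
  "strongly_metrically_regular F xb yb \<longleftrightarrow>
     (\<exists>\<mu>. metrically_regular F xb yb \<mu>) \<and> single_valued_localization (inv_map F) yb xb"

definition coderivative_directions ::
  "('a::real_inner \<Rightarrow> 'a set) \<Rightarrow> 'a \<Rightarrow> 'a \<Rightarrow> 'a set" where
  "coderivative_directions F x v = {d. - v \<in> coderivative F x v d}"

end

theory Submission
  imports Defs
begin

text \<open>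
  Near the reference point, strong metric regularity turns the graph of \<open>F\<close> into the graph
  \<open>{(s w, w)}\<close> of a Lipschitz localization \<open>s\<close> of the inverse
  (\<open>strongly_metrically_regular_lipschitz_graph\<close>). Since \<open>- v \<in> D\<^sup>*F(x, v)(d)\<close> says that
  \<open>(- v, - d)\<close> is a limiting normal to this graph at \<open>(x, v) = (s v, v)\<close>, both claims are
  statements about normals \<open>(u, \<xi>)\<close> with a prescribed first component \<open>u\<close>.

  Such \<open>\<xi>\<close> are the limiting subgradients at \<open>v\<close> of the Lipschitz function
  \<open>\<phi> w = - inner u (s w)\<close>. To find one, minimize \<open>\<phi> w + k * (norm (w - v))\<^sup>2\<close> near \<open>v\<close>:
  for large \<open>k\<close> a minimizer \<open>w\<close> is close to \<open>v\<close>, and the quadratic term supports \<open>\<phi>\<close> there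
  from below, which makes \<open>(u, - 2 * k * (w - v))\<close> a regular normal at \<open>(s w, w)\<close>
  (\<open>proximal_normal_to_lipschitz_graph\<close>). The Lipschitz bound on \<open>\<phi>\<close> keeps
  \<open>k * norm (w - v)\<close> bounded, so a subsequence converges as \<open>k\<close> tends to infinity and yields
  the limiting normal (\<open>limiting_normal_to_lipschitz_graph_exists\<close>).

  For compactness, limiting normal cones are closed, and testing a normal \<open>(u, \<xi>)\<close> in the
  direction \<open>\<xi>\<close> gives \<open>norm \<xi> \<le> L * norm u\<close>, where \<open>L\<close> is a Lipschitz constant of \<open>s\<close>
  (\<open>limiting_normal_to_lipschitz_graph_bound\<close>).
\<close>

section \<open>Regular and limiting normal cones\<close>

text \<open>Clearing the denominator turns the upper limit into an inequality that can be tested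
  along curves and is implied by any quadratic estimate of the inner product.\<close>

lemma regular_normal_cone_iff:
  "v \<in> regular_normal_cone S z \<longleftrightarrow>
     (\<forall>\<epsilon>>0. \<forall>\<^sub>F w in at z within S. inner v (w - z) \<le> \<epsilon> * norm (w - z))"
proof -
  have quotient: "inner v (w - z) \<le> \<epsilon> * norm (w - z) \<longleftrightarrow> inner v (w - z) / norm (w - z) \<le> \<epsilon>"
    if "w \<noteq> z" for w \<epsilon>
    using that by (simp add: divide_le_eq)
  have away: "\<forall>\<^sub>F w in at z within S. w \<noteq> z"
    by (simp add: eventually_at_filter)
  have "v \<in> regular_normal_cone S z \<longleftrightarrow>
      (\<forall>y>0. \<forall>\<^sub>F w in at z within S. ereal (inner v (w - z) / norm (w - z)) < y)"
    unfolding regular_normal_cone_def mem_Collect_eq Limsup_le_iff ..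
  also have "\<dots> \<longleftrightarrow> (\<forall>\<epsilon>>0. \<forall>\<^sub>F w in at z within S. inner v (w - z) / norm (w - z) \<le> \<epsilon>)"
  proof (intro iffI allI impI)
    fix \<epsilon> :: real assume "0 < \<epsilon>"
      and "\<forall>y>0. \<forall>\<^sub>F w in at z within S. ereal (inner v (w - z) / norm (w - z)) < y"
    then have "\<forall>\<^sub>F w in at z within S. ereal (inner v (w - z) / norm (w - z)) < ereal \<epsilon>"
      by (metis ereal_less(2))
    then show "\<forall>\<^sub>F w in at z within S. inner v (w - z) / norm (w - z) \<le> \<epsilon>"
      by (rule eventually_mono) simp
  next
    fix y :: ereal assume "0 < y"
      and *: "\<forall>\<epsilon>>0. \<forall>\<^sub>F w in at z within S. inner v (w - z) / norm (w - z) \<le> \<epsilon>"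
    then obtain \<epsilon> where \<epsilon>: "0 < ereal \<epsilon>" "ereal \<epsilon> < y"
      using ereal_dense2 by blast
    have "\<forall>\<^sub>F w in at z within S. inner v (w - z) / norm (w - z) \<le> \<epsilon>"
      using * \<epsilon>(1) by simp
    then show "\<forall>\<^sub>F w in at z within S. ereal (inner v (w - z) / norm (w - z)) < y"
      by (rule eventually_mono) (use \<epsilon>(2) in \<open>meson ereal_less_eq(3) le_less_trans\<close>)
  qed
  also have "\<dots> \<longleftrightarrow> (\<forall>\<epsilon>>0. \<forall>\<^sub>F w in at z within S. inner v (w - z) \<le> \<epsilon> * norm (w - z))"
    by (intro all_cong1 imp_cong refl eventually_cong[OF away]) (simp add: quotient)
  finally show ?thesis .
qed

text \<open>The limiting cone is a slice of the closure of the graph of the regular cone; a direct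
  proof of its closedness from sequences would need a diagonal argument.\<close>

lemma limiting_normal_cone_iff_closure:
  "v \<in> limiting_normal_cone S z \<longleftrightarrow>
     (z, v) \<in> closure {(z', v'). z' \<in> S \<and> v' \<in> regular_normal_cone S z'}" (is "?L \<longleftrightarrow> ?R")
proof
  assume ?L
  then obtain zs vs where "zs \<longlonglongrightarrow> z" "vs \<longlonglongrightarrow> v"
    "\<And>k::nat. zs k \<in> S \<and> vs k \<in> regular_normal_cone S (zs k)"
    unfolding limiting_normal_cone_def by blast
  then show ?R
    unfolding closure_sequential
    by (intro exI[of _ "\<lambda>k. (zs k, vs k)"]) (auto intro: tendsto_Pair)
next
  assume ?R
  then obtain p where p: "\<And>k::nat. fst (p k) \<in> S \<and> snd (p k) \<in> regular_normal_cone S (fst (p k))"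
    "p \<longlonglongrightarrow> (z, v)"
    unfolding closure_sequential by (auto simp: case_prod_unfold)
  show ?L
    unfolding limiting_normal_cone_def mem_Collect_eq
    using p(1) tendsto_fst[OF p(2)] tendsto_snd[OF p(2)]
    by (intro exI[of _ "\<lambda>k. fst (p k)"] exI[of _ "\<lambda>k. snd (p k)"]) simp
qed

lemma closed_limiting_normal_cone: "closed (limiting_normal_cone S z)"
proof -
  have "limiting_normal_cone S z =
      Pair z -` closure {(z', v'). z' \<in> S \<and> v' \<in> regular_normal_cone S z'}"
    by (auto simp: limiting_normal_cone_iff_closure)
  then show ?thesis
    by (simp add: closed_vimage continuous_on_Pair continuous_on_id)
qed

section \<open>Normals to the graph of a Lipschitz map\<close>

text \<open>Graphs are written with the argument of the map in the second component, as for a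
  localization of an inverse. Moving the argument from \<open>w\<close> by a small step \<open>r\<close> in the
  direction of \<open>b\<close> changes \<open>inner (a, b)\<close> by \<open>r * norm b\<close> through the second component and by
  at least \<open>- norm a * L * r\<close> through the first. Normality forces the sum to be at most
  \<open>o(r)\<close>.\<close>

lemma regular_normal_to_lipschitz_graph_bound:
  fixes s :: "'b::real_inner \<Rightarrow> 'a::real_inner"
  assumes lip: "L-lipschitz_on B s" and "open B" and sub: "(\<lambda>w. (s w, w)) ` B \<subseteq> S"
    and "w \<in> B" and normal: "(a, b) \<in> regular_normal_cone S (s w, w)"
  shows "norm b \<le> L * norm a"
proof (cases "b = 0")
  case True
  then show ?thesis using lipschitz_on_nonneg[OF lip] by simp
next
  case False
  have L: "0 \<le> L" by (rule lipschitz_on_nonneg[OF lip])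
  obtain e where e: "0 < e" "ball w e \<subseteq> B"
    using \<open>open B\<close> \<open>w \<in> B\<close> open_contains_ball by blast
  have "norm b \<le> L * norm a + \<eta>" if "0 < \<eta>" for \<eta>
  proof -
    \<comment> \<open>A step of length \<open>r\<close> in the argument moves the graph point by at most \<open>(L + 1) * r\<close>.\<close>
    define \<epsilon> where "\<epsilon> = \<eta> / (L + 1)"
    have "0 < \<epsilon>" using \<open>0 < \<eta>\<close> L by (simp add: \<epsilon>_def)
    then obtain \<delta> where \<delta>: "0 < \<delta>"
      "\<And>p. p \<in> S \<Longrightarrow> p \<noteq> (s w, w) \<Longrightarrow> dist p (s w, w) < \<delta> \<Longrightarrow>
         inner (a, b) (p - (s w, w)) \<le> \<epsilon> * norm (p - (s w, w))"
      using normal unfolding regular_normal_cone_iff eventually_at by meson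
    define c where "c = \<delta> / (L + 1)"
    define r where "r = min e c / 2"
    have "0 < c" using \<delta>(1) L by (simp add: c_def)
    then have r: "0 < r" "r < e" and "r < c"
      using e(1) by (auto simp: r_def min_def)
    then have rL: "(L + 1) * r < \<delta>"
      using L by (simp add: c_def pos_less_divide_eq mult.commute)
    define w' where "w' = w + (r / norm b) *\<^sub>R b"
    have dw: "norm (w' - w) = r"
      using r(1) False by (simp add: w'_def)
    have w': "w' \<in> B"
      using e(2) dw r(2) by (auto simp: dist_norm norm_minus_commute)
    have ds: "norm (s w' - s w) \<le> L * r"
      using lipschitz_onD[OF lip w' \<open>w \<in> B\<close>] by (simp add: dist_norm dw)
    have dp: "norm ((s w', w') - (s w, w)) \<le> (L + 1) * r"
      using norm_Pair_le[of "s w' - s w" "w' - w"] ds dw by (simp add: algebra_simps)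
    have "w' \<noteq> w" using dw r(1) by auto
    then have "inner (a, b) ((s w', w') - (s w, w)) \<le> \<epsilon> * norm ((s w', w') - (s w, w))"
      using sub w' dp rL by (intro \<delta>(2)) (auto simp: dist_norm)
    also have "\<dots> \<le> \<epsilon> * ((L + 1) * r)"
      using dp \<open>0 < \<epsilon>\<close> by (intro mult_left_mono) auto
    also have "\<dots> = \<eta> * r" using L by (simp add: \<epsilon>_def)
    finally have "inner a (s w' - s w) + inner b (w' - w) \<le> \<eta> * r" by simp
    moreover have "inner b (w' - w) = norm b * r"
      using False by (simp add: w'_def dot_square_norm power2_eq_square)
    moreover have "- inner a (s w' - s w) \<le> norm a * (L * r)"
      using Cauchy_Schwarz_ineq2[of a "s w' - s w"] mult_left_mono[OF ds norm_ge_zero[of a]]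
      by linarith
    ultimately have "norm b * r \<le> (L * norm a + \<eta>) * r"
      by (simp add: algebra_simps)
    then show ?thesis using r(1) by simp
  qed
  then show ?thesis by (rule field_le_epsilon)
qed

text \<open>The point \<open>w\<close> minimizes \<open>k * (norm (w - v))\<^sup>2 - inner u (s w)\<close> over \<open>cball v r\<close>.
  Comparison with the value at \<open>v\<close> bounds \<open>k * norm (w - v)\<close> by \<open>L * norm u\<close>, which by the
  choice of \<open>k\<close> puts \<open>w\<close> in the interior of the ball, so that nearby graph points may be
  compared with it. The bound on \<open>\<xi>\<close> does not depend on \<open>k\<close>.\<close>

lemma proximal_normal_to_lipschitz_graph:
  fixes s :: "'b::euclidean_space \<Rightarrow> 'a::real_inner"
  assumes lip: "L-lipschitz_on B s" and "open A" "open B"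
    and graph: "S \<inter> (A \<times> B) = (\<lambda>w. (s w, w)) ` B"
    and r: "cball v r \<subseteq> B" and k: "L * norm u < k * r" and "0 < k"
  obtains w \<xi> where "w \<in> B" "dist w v \<le> L * norm u / k" "norm \<xi> \<le> 2 * L * norm u"
    "(u, \<xi>) \<in> regular_normal_cone S (s w, w)"
proof -
  have L: "0 \<le> L" by (rule lipschitz_on_nonneg[OF lip])
  have "0 \<le> L * norm u" using L by simp
  then have "0 < r" using k \<open>0 < k\<close> by (meson le_less_trans zero_less_mult_pos)
  then have "v \<in> cball v r" by simp
  then have "v \<in> B" using r by blast
  define h where "h = (\<lambda>w. k * (norm (w - v))\<^sup>2 - inner u (s w))"
  have "continuous_on (cball v r) h"
    unfolding h_def
    by (intro continuous_intros continuous_on_subset[OF lipschitz_on_continuous_on[OF lip] r])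
  then obtain w where w: "w \<in> cball v r" "\<And>w'. w' \<in> cball v r \<Longrightarrow> h w \<le> h w'"
    using continuous_attains_inf[OF compact_cball, of v r h] \<open>v \<in> cball v r\<close> by blast
  have "w \<in> B" using w(1) r by blast
  have "norm (s w - s v) \<le> L * norm (w - v)"
    using lipschitz_onD[OF lip \<open>w \<in> B\<close> \<open>v \<in> B\<close>] by (simp add: dist_norm)
  then have "inner u (s w - s v) \<le> norm u * (L * norm (w - v))"
    using Cauchy_Schwarz_ineq2[of u "s w - s v"]
      mult_left_mono[OF _ norm_ge_zero[of u], of "norm (s w - s v)" "L * norm (w - v)"]
    by linarith
  moreover have "k * (norm (w - v))\<^sup>2 \<le> inner u (s w - s v)"
    using w(2)[OF \<open>v \<in> cball v r\<close>] by (simp add: h_def inner_diff_right)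
  ultimately have "(k * norm (w - v)) * norm (w - v) \<le> (L * norm u) * norm (w - v)"
    by (simp add: power2_eq_square algebra_simps)
  then have dk: "k * norm (w - v) \<le> L * norm u"
    using L by (cases "w = v") auto
  then have dist_wv: "dist w v \<le> L * norm u / k"
    using \<open>0 < k\<close> by (simp add: dist_norm field_simps)
  have "w \<in> ball v r"
    using dk k \<open>0 < k\<close> by (simp add: dist_norm norm_minus_commute)
      (metis le_less_trans mult_less_cancel_left_pos)
  \<comment> \<open>Minus the gradient of the penalty term at \<open>w\<close>.\<close>
  define \<xi> where "\<xi> = (- 2 * k) *\<^sub>R (w - v)"
  have "norm \<xi> \<le> 2 * L * norm u"
    using dk \<open>0 < k\<close> by (simp add: \<xi>_def abs_mult)
  have "(s w, w) \<in> A \<times> B" using graph \<open>w \<in> B\<close> by blast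
  have "(u, \<xi>) \<in> regular_normal_cone S (s w, w)"
    unfolding regular_normal_cone_iff
  proof (intro allI impI)
    fix \<epsilon> :: real assume "0 < \<epsilon>"
    \<comment> \<open>The last ball is small enough for \<open>k * norm\<^sup>2\<close> to be dominated by \<open>\<epsilon> * norm\<close>.\<close>
    define N where "N = A \<times> (B \<inter> ball v r) \<inter> ball (s w, w) (\<epsilon> / k)"
    have "open N" "(s w, w) \<in> N"
      using \<open>open A\<close> \<open>open B\<close> \<open>(s w, w) \<in> A \<times> B\<close> \<open>w \<in> ball v r\<close> \<open>0 < \<epsilon>\<close> \<open>0 < k\<close>
      by (auto simp: N_def intro!: open_Times)
    have "inner (u, \<xi>) (p - (s w, w)) \<le> \<epsilon> * norm (p - (s w, w))" if "p \<in> S" "p \<in> N" for p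
    proof -
      have "p \<in> S \<inter> (A \<times> B)" using that by (auto simp: N_def)
      then obtain w' where p: "p = (s w', w')" "w' \<in> B" unfolding graph by blast
      have "w' \<in> cball v r" using that p by (auto simp: N_def)
      then have "h w \<le> h w'" by (rule w(2))
      moreover have "(norm (w' - v))\<^sup>2 =
          (norm (w' - w))\<^sup>2 + 2 * inner (w - v) (w' - w) + (norm (w - v))\<^sup>2"
        unfolding power2_norm_eq_inner by (simp add: inner_diff inner_commute)
      ultimately have "inner u (s w' - s w) \<le> k * ((norm (w' - w))\<^sup>2 + 2 * inner (w - v) (w' - w))"
        by (simp add: h_def inner_diff_right algebra_simps)
      then have "inner (u, \<xi>) (p - (s w, w)) \<le> k * (norm (w' - w))\<^sup>2"
        by (simp add: p \<xi>_def algebra_simps)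
      also have "\<dots> \<le> k * (norm (p - (s w, w)))\<^sup>2"
        using norm_snd_le[of "w' - w" "s w' - s w"] \<open>0 < k\<close> by (simp add: p)
      also have "\<dots> = (k * norm (p - (s w, w))) * norm (p - (s w, w))"
        by (simp add: power2_eq_square)
      also have "\<dots> \<le> \<epsilon> * norm (p - (s w, w))"
      proof (rule mult_right_mono)
        have "norm (p - (s w, w)) < \<epsilon> / k"
          using that(2) by (simp add: N_def dist_norm norm_minus_commute)
        then show "k * norm (p - (s w, w)) \<le> \<epsilon>"
          using \<open>0 < k\<close> by (simp add: field_simps)
      qed simp
      finally show ?thesis .
    qed
    then show "\<forall>\<^sub>F p in at (s w, w) within S. inner (u, \<xi>) (p - (s w, w)) \<le> \<epsilon> * norm (p - (s w, w))"
      unfolding eventually_at_topological using \<open>open N\<close> \<open>(s w, w) \<in> N\<close> by blast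
  qed
  then show thesis
    using that \<open>w \<in> B\<close> dist_wv \<open>norm \<xi> \<le> 2 * L * norm u\<close> by blast
qed

text \<open>Let the penalty parameter tend to infinity: the minimizers converge to \<open>v\<close>, and the
  second components of their normals stay in a fixed compact ball.\<close>

lemma limiting_normal_to_lipschitz_graph_exists:
  fixes s :: "'b::euclidean_space \<Rightarrow> 'a::real_inner"
  assumes lip: "L-lipschitz_on B s" and "open A" "open B"
    and graph: "S \<inter> (A \<times> B) = (\<lambda>w. (s w, w)) ` B" and "v \<in> B"
  shows "\<exists>\<xi>. (u, \<xi>) \<in> limiting_normal_cone S (s v, v)"
proof -
  obtain r where r: "0 < r" "cball v r \<subseteq> B"
    using \<open>open B\<close> \<open>v \<in> B\<close> open_contains_cball by blast
  \<comment> \<open>The offset makes every \<open>k n\<close> large enough to keep the minimizer inside \<open>ball v r\<close>.\<close>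
  define k where "k n = L * norm u / r + real (Suc n)" for n
  have "0 \<le> L * norm u / r" using r(1) lipschitz_on_nonneg[OF lip] by simp
  then have k: "0 < k n" "L * norm u < k n * r" for n
    using r(1) mult_pos_pos[OF of_nat_0_less_iff[THEN iffD2, OF zero_less_Suc] r(1), of n]
    by (simp_all add: k_def distrib_right del: of_nat_Suc)
  have "\<exists>w \<xi>. w \<in> B \<and> dist w v \<le> L * norm u / k n \<and> norm \<xi> \<le> 2 * L * norm u \<and>
      (u, \<xi>) \<in> regular_normal_cone S (s w, w)" for n
    by (rule proximal_normal_to_lipschitz_graph[OF lip \<open>open A\<close> \<open>open B\<close> graph r(2) k(2) k(1)])
      blast
  then obtain w \<xi> where w: "\<And>n. w n \<in> B" "\<And>n. dist (w n) v \<le> L * norm u / k n"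
    and \<xi>: "\<And>n. norm (\<xi> n) \<le> 2 * L * norm u"
      "\<And>n. (u, \<xi> n) \<in> regular_normal_cone S (s (w n), w n)"
    by metis
  have "filterlim k at_top sequentially"
    unfolding k_def
    by (rule filterlim_tendsto_add_at_top[OF tendsto_const
          filterlim_compose[OF filterlim_real_sequentially filterlim_Suc]])
  then have "(\<lambda>n. L * norm u / k n) \<longlonglongrightarrow> 0"
    by (rule real_tendsto_divide_at_top[OF tendsto_const])
  then have "w \<longlonglongrightarrow> v"
  proof (rule metric_tendsto_imp_tendsto, intro always_eventually allI)
    show "dist (w n) v \<le> dist (L * norm u / k n) 0" for n
      using order_trans[OF w(2) abs_ge_self] by simp
  qed
  have "(\<lambda>n. s (w n)) \<longlonglongrightarrow> s v"
    by (rule continuous_on_tendsto_compose[OF lipschitz_on_continuous_on[OF lip]])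
      (use \<open>w \<longlonglongrightarrow> v\<close> \<open>v \<in> B\<close> w(1) in auto)
  have "\<And>n. \<xi> n \<in> cball 0 (2 * L * norm u)" using \<xi>(1) by simp
  then obtain l \<phi> where "strict_mono \<phi>" and l: "(\<xi> \<circ> \<phi>) \<longlonglongrightarrow> l"
    using compact_cball[of 0 "2 * L * norm u"] unfolding compact_def by meson
  have "(\<lambda>n. (s (w (\<phi> n)), w (\<phi> n))) \<longlonglongrightarrow> (s v, v)"
    using LIMSEQ_subseq_LIMSEQ[OF \<open>w \<longlonglongrightarrow> v\<close> \<open>strict_mono \<phi>\<close>]
      LIMSEQ_subseq_LIMSEQ[OF \<open>(\<lambda>n. s (w n)) \<longlonglongrightarrow> s v\<close> \<open>strict_mono \<phi>\<close>]
    by (auto simp: o_def intro: tendsto_Pair)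
  moreover have "(\<lambda>n. (u, \<xi> (\<phi> n))) \<longlonglongrightarrow> (u, l)"
    using l by (auto simp: o_def intro: tendsto_Pair)
  moreover have "(s (w n), w n) \<in> S" for n using graph w(1) by blast
  ultimately have "(u, l) \<in> limiting_normal_cone S (s v, v)"
    unfolding limiting_normal_cone_def using \<xi>(2) by blast
  then show ?thesis ..
qed

lemma limiting_normal_to_lipschitz_graph_bound:
  fixes s :: "'b::real_inner \<Rightarrow> 'a::real_inner"
  assumes lip: "L-lipschitz_on B s" and "open A" "open B"
    and graph: "S \<inter> (A \<times> B) = (\<lambda>w. (s w, w)) ` B" and "(x, v) \<in> A \<times> B"
    and normal: "(a, b) \<in> limiting_normal_cone S (x, v)"
  shows "norm b \<le> L * norm a"
proof -
  obtain zs vs where zs: "zs \<longlonglongrightarrow> (x, v)" "\<And>k::nat. zs k \<in> S"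
    and vs: "vs \<longlonglongrightarrow> (a, b)" "\<And>k. vs k \<in> regular_normal_cone S (zs k)"
    using normal unfolding limiting_normal_cone_def by blast
  have sub: "(\<lambda>w. (s w, w)) ` B \<subseteq> S" using graph by blast
  have "\<forall>\<^sub>F k in sequentially. zs k \<in> A \<times> B"
    by (rule topological_tendstoD[OF zs(1) open_Times[OF \<open>open A\<close> \<open>open B\<close>] \<open>(x, v) \<in> A \<times> B\<close>])
  then have "\<forall>\<^sub>F k in sequentially. norm (snd (vs k)) \<le> L * norm (fst (vs k))"
  proof (rule eventually_mono)
    fix k assume "zs k \<in> A \<times> B"
    then have "zs k \<in> S \<inter> (A \<times> B)" using zs(2) by simp
    then obtain w where w: "w \<in> B" "zs k = (s w, w)"
      unfolding graph by blast
    show "norm (snd (vs k)) \<le> L * norm (fst (vs k))"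
      using vs(2)[of k]
      by (intro regular_normal_to_lipschitz_graph_bound[OF lip \<open>open B\<close> sub w(1)]) (simp add: w(2))
  qed
  moreover have "(\<lambda>k. norm (snd (vs k))) \<longlonglongrightarrow> norm b"
    using tendsto_norm[OF tendsto_snd[OF vs(1)]] by simp
  moreover have "(\<lambda>k. L * norm (fst (vs k))) \<longlonglongrightarrow> L * norm a"
    using tendsto_mult_left[OF tendsto_norm[OF tendsto_fst[OF vs(1)]]] by simp
  ultimately show ?thesis
    by (intro tendsto_le[OF sequentially_bot])
qed

section \<open>The localized inverse of a strongly metrically regular map\<close>

text \<open>If \<open>y' \<in> F x\<close>, metric regularity gives points of \<open>inv_map F y\<close> at distance at most
  about \<open>\<mu> * dist y y'\<close> from \<open>x\<close>. Such a point is the value at \<open>y\<close> of the single-valued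
  localization only if it lies in the neighborhood \<open>U0\<close> on which that is unique. Hence the
  estimate is used twice: from \<open>xb\<close>, to see that the values stay near \<open>xb\<close>, and then between
  two such values, where the first step keeps the nearby point inside \<open>U0\<close>.\<close>

lemma strongly_metrically_regular_lipschitz_graph:
  fixes F :: "'a::metric_space \<Rightarrow> 'b::metric_space set"
  assumes base: "(xb, vb) \<in> gph F" and smr: "strongly_metrically_regular F xb vb"
  obtains A B s L where "open A" "xb \<in> A" "open B" "vb \<in> B" "L-lipschitz_on B s"
    "gph F \<inter> (A \<times> B) = (\<lambda>w. (s w, w)) ` B"
proof -
  obtain \<mu> U1 V1 where \<mu>: "0 < \<mu>" and "nbhd xb U1" "nbhd vb V1"
    and reg: "\<And>x y. x \<in> U1 \<Longrightarrow> y \<in> V1 \<Longrightarrow>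
      set_dist x (inv_map F y) \<le> ereal \<mu> * set_dist y (F x)"
    using smr unfolding strongly_metrically_regular_def metrically_regular_def by blast
  obtain U0 V0 where "nbhd xb U0" "nbhd vb V0"
    and unique: "\<And>y. y \<in> V0 \<Longrightarrow> \<exists>!x. (y, x) \<in> gph (inv_map F) \<inter> (V0 \<times> U0)"
    using smr unfolding strongly_metrically_regular_def single_valued_localization_def by blast
  have "xb \<in> interior (U0 \<inter> U1)" "vb \<in> interior (V0 \<inter> V1)"
    using \<open>nbhd xb U0\<close> \<open>nbhd xb U1\<close> \<open>nbhd vb V0\<close> \<open>nbhd vb V1\<close> by (auto simp: nbhd_def)
  then obtain r q where "0 < r" and rU: "ball xb r \<subseteq> U0 \<inter> U1"
    and "0 < q" and qV: "ball vb q \<subseteq> V0 \<inter> V1"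
    unfolding mem_interior by blast
  define s where "s y = (THE x. x \<in> U0 \<and> y \<in> F x)" for y
  have s_eq: "x = s y" if "y \<in> V0" "x \<in> U0" "y \<in> F x" for x y
  proof -
    have "\<exists>!x. x \<in> U0 \<and> y \<in> F x"
      using unique[OF that(1)] that(1) by (simp add: gph_def inv_map_def conj_commute)
    then show ?thesis unfolding s_def using that by (metis (mono_tags, lifting) theI')
  qed
  have near: "\<exists>x'. y \<in> F x' \<and> dist x x' < \<mu> * dist y y' + \<epsilon>"
    if "x \<in> U1" "y \<in> V1" "y' \<in> F x" "0 < \<epsilon>" for x y y' \<epsilon>
  proof -
    have "set_dist y (F x) \<le> ereal (dist y y')"
      unfolding set_dist_def using that(3) by (rule INF_lower)
    then have "ereal \<mu> * set_dist y (F x) \<le> ereal \<mu> * ereal (dist y y')"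
      using \<mu> by (intro ereal_mult_left_mono) auto
    then have "set_dist x (inv_map F y) \<le> ereal (\<mu> * dist y y')"
      using reg[OF that(1,2)] by simp
    also have "\<dots> < ereal (\<mu> * dist y y' + \<epsilon>)" using that(4) by simp
    finally show ?thesis
      unfolding set_dist_def INF_less_iff by (auto simp: inv_map_def)
  qed
  \<comment> \<open>Values on \<open>ball vb \<delta>\<close> stay within \<open>r / 3\<close> of \<open>xb\<close>. Two arguments are less than \<open>2 * \<delta>\<close>
    apart, which costs at most another \<open>2 * r / 3\<close> in the second use of the estimate.\<close>
  define \<delta> where "\<delta> = min q (r / (3 * (\<mu> + 1)))"
  have "\<delta> \<le> r / (3 * (\<mu> + 1))" by (simp add: \<delta>_def)
  then have \<delta>: "0 < \<delta>" "\<delta> \<le> q" "(\<mu> + 1) * \<delta> \<le> r / 3"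
    using \<open>0 < r\<close> \<open>0 < q\<close> \<mu> by (simp add: \<delta>_def, simp add: \<delta>_def, simp add: field_simps)
  have BV: "y \<in> V0" "y \<in> V1" if "y \<in> ball vb \<delta>" for y
    using that qV \<delta>(2) by (auto simp: subset_eq)
  have s_near: "y \<in> F (s y) \<and> dist xb (s y) < r / 3" if y: "y \<in> ball vb \<delta>" for y
  proof -
    have "xb \<in> U1" "vb \<in> F xb" using rU \<open>0 < r\<close> base by (auto simp: gph_def)
    then obtain x where x: "y \<in> F x" "dist xb x < \<mu> * dist y vb + \<delta>"
      using near[of xb y vb \<delta>] BV(2)[OF y] \<delta>(1) by blast
    have "\<mu> * dist y vb \<le> \<mu> * \<delta>" using y \<mu> by (simp add: dist_commute)
    then have dx: "dist xb x < r / 3" using x(2) \<delta>(3) by (simp add: algebra_simps)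
    then have "x \<in> U0" using rU \<open>0 < r\<close> by (auto simp: subset_eq)
    then have "x = s y" using s_eq BV(1)[OF y] x(1) by blast
    then show ?thesis using x(1) dx by blast
  qed
  have lip: "\<mu>-lipschitz_on (ball vb \<delta>) s"
  proof (rule lipschitz_onI)
    fix y' y assume y': "y' \<in> ball vb \<delta>" and y: "y \<in> ball vb \<delta>"
    have "dist (s y') (s y) \<le> \<mu> * dist y y' + \<epsilon>" if "0 < \<epsilon>" for \<epsilon>
    proof -
      have "s y' \<in> U1" using s_near[OF y'] rU \<open>0 < r\<close> by (auto simp: subset_eq)
      then obtain x where x: "y \<in> F x" "dist (s y') x < \<mu> * dist y y' + min \<epsilon> \<delta>"
        using near[of "s y'" y y' "min \<epsilon> \<delta>"] BV(2)[OF y] s_near[OF y'] \<delta>(1) \<open>0 < \<epsilon>\<close> by auto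
      have "dist y y' \<le> 2 * \<delta>"
        using dist_triangle2[of y y' vb] y y' by (simp add: dist_commute)
      then have "\<mu> * dist y y' \<le> \<mu> * (2 * \<delta>)" using \<mu> by simp
      then have "dist (s y') x < 2 * ((\<mu> + 1) * \<delta>)"
        using x(2) \<delta>(1) by (simp add: algebra_simps)
      then have "dist xb x < r"
        using s_near[OF y'] \<delta>(3) dist_triangle[of xb x "s y'"] by linarith
      then have "x \<in> U0" using rU by (auto simp: subset_eq)
      then have "x = s y" using s_eq BV(1)[OF y] x(1) by blast
      then show ?thesis using x(2) by simp
    qed
    then show "dist (s y') (s y) \<le> \<mu> * dist y' y"
      unfolding dist_commute[of y' y] by (rule field_le_epsilon)
  qed (use \<mu> in simp)
  have "gph F \<inter> (ball xb r \<times> ball vb \<delta>) = (\<lambda>w. (s w, w)) ` ball vb \<delta>"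
  proof (intro equalityI subsetI)
    fix p assume "p \<in> gph F \<inter> (ball xb r \<times> ball vb \<delta>)"
    then obtain x y where p: "p = (x, y)" "y \<in> F x" "x \<in> ball xb r" "y \<in> ball vb \<delta>"
      by (auto simp: gph_def)
    then have "x = s y" using s_eq BV(1) rU by blast
    then show "p \<in> (\<lambda>w. (s w, w)) ` ball vb \<delta>" using p by blast
  next
    fix p assume "p \<in> (\<lambda>w. (s w, w)) ` ball vb \<delta>"
    then show "p \<in> gph F \<inter> (ball xb r \<times> ball vb \<delta>)"
      using s_near \<open>0 < r\<close> by (fastforce simp: gph_def)
  qed
  then show thesis
    using that[of "ball xb r" "ball vb \<delta>" \<mu> s] lip \<open>0 < r\<close> \<delta>(1) by simp
qed

section \<open>Existence and compactness of coderivative directions\<close>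

theorem theorem3p4:
  fixes F :: "real ^ 'n \<Rightarrow> (real ^ 'n) set" and xb vb :: "real ^ 'n"
  assumes "(xb, vb) \<in> gph F"
    and "locally_closed_around (gph F) (xb, vb)"
    and "strongly_metrically_regular F xb vb"
  shows "\<exists>U V. open U \<and> xb \<in> U \<and> open V \<and> vb \<in> V \<and>
           (\<forall>(x, v) \<in> gph F \<inter> (U \<times> V). \<exists>d. - v \<in> coderivative F x v d) \<and>
           (\<forall>(x, v) \<in> gph F \<inter> (U \<times> V). compact (coderivative_directions F x v))"
proof -
  obtain A B s L where AB: "open A" "xb \<in> A" "open B" "vb \<in> B" and lip: "L-lipschitz_on B s"
    and graph: "gph F \<inter> (A \<times> B) = (\<lambda>w. (s w, w)) ` B"
    by (rule strongly_metrically_regular_lipschitz_graph[OF assms(1,3)])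
  have "\<exists>d. - v \<in> coderivative F x v d" if "(x, v) \<in> gph F \<inter> (A \<times> B)" for x v
  proof -
    have "v \<in> B" "x = s v" using that unfolding graph by auto
    then obtain \<xi> where "(- v, \<xi>) \<in> limiting_normal_cone (gph F) (x, v)"
      using limiting_normal_to_lipschitz_graph_exists[OF lip AB(1,3) graph] by blast
    then show ?thesis by (intro exI[of _ "- \<xi>"]) (simp add: coderivative_def)
  qed
  moreover have "compact (coderivative_directions F x v)"
    if "(x, v) \<in> gph F \<inter> (A \<times> B)" for x v
  proof -
    have eq: "coderivative_directions F x v =
        (\<lambda>d. (- v, - d)) -` limiting_normal_cone (gph F) (x, v)"
      by (auto simp: coderivative_directions_def coderivative_def)
    have "closed (coderivative_directions F x v)"
      unfolding eq by (intro closed_vimage closed_limiting_normal_cone continuous_intros)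
    moreover have "norm d \<le> L * norm v" if "d \<in> coderivative_directions F x v" for d
      using limiting_normal_to_lipschitz_graph_bound[OF lip AB(1,3) graph, of x v "- v" "- d"]
        that \<open>(x, v) \<in> gph F \<inter> (A \<times> B)\<close> unfolding eq by simp
    then have "bounded (coderivative_directions F x v)"
      unfolding bounded_iff by blast
    ultimately show ?thesis by (simp add: compact_eq_bounded_closed)
  qed
  ultimately show ?thesis using AB by (intro exI[of _ A] exI[of _ B]) blast
qed

end
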